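(* Let $n,m,p$ be positive integers with $m\ge p$, let $A_{\rm m}\in\mathbb{R}^{n\times n}$ be Schur and $B_{\rm m}\in\mathbb{R}^{n\times p}$. Let $D^A,D^B\in\mathbb{S}^n$ with $D^A\ge 0$, $D^B\ge 0$, and let $\Gamma^A\in\mathbb{R}^{n\times n}$, $\Gamma^B\in\mathbb{R}^{p\times p}$ be diagonal with positive diagonal entries. Define $$R=\begin{bmatrix} R_{11} & R_{12} \\ R_{21} & R_{22} \end{bmatrix}:=\begin{bmatrix} D^A-A_{\rm m}\Gamma^AA_{\rm m}^{\top} & A_{\rm m}\Gamma^A \\ \Gamma^AA_{\rm m}^{\top} & -\Gamma^A \end{bmatrix},\qquad \Psi(\lambda):=R_{11}+R_{22}+\lambda R_{12}+\lambda^{-1}R_{21}.$$ Assume that $\Psi(1)$ is invertible and that the matrix $$\begin{bmatrix} 0 & \Psi(1)^{-1} \\ \Psi(-1) & 2(R_{12}-R_{21})\Psi(1)^{-1} \end{bmatrix}$$ has no eigenvalues on the imaginary axis. Then, given $K\in\mathbb{R}^{m\times n}$ and $L\in\mathbb{R}^{m\times p}$ such that $\Sigma^{K,L}\neq\emptyset$, the matrix $A+BK$ is Schur for all $(A,B)\in\Sigma^{K,L}$ if and only if $$\begin{bmatrix} I \\ A_{\rm m}^{\top}-I \end{bmatrix}^{\top}\begin{bmatrix} -D^A & 0 \\ 0 & \Gamma^A \end{bmatrix}\begin{bmatrix} I \\ A_{\rm m}^{\top}-I \end{bmatrix}>0.$$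
   Context: $\mathbb{S}^n$ is the space of real symmetric $n\times n$ matrices; $\ge0$ means positive semidefinite and $>0$ means positive definite. A square real matrix is Schur if all its eigenvalues have modulus strictly less than $1$. The imaginary axis is the set of complex numbers with zero real part (including $0$). For $K\in\mathbb{R}^{m\times n}$, $L\in\mathbb{R}^{m\times p}$, $$\Sigma^{K,L}=\{(A,B)\in\mathbb{R}^{n\times n}\times\mathbb{R}^{n\times m}\mid D^A\ge(A+BK-A_{\rm m})\Gamma^A(A+BK-A_{\rm m})^\top,\ D^B\ge(BL-B_{\rm m})\Gamma^B(BL-B_{\rm m})^\top\}.$$ *)

theory Defs
  imports Complex_Main "Jordan_Normal_Form.Spectral_Radius"
    "Jordan_Normal_Form.Gauss_Jordan_Elimination"
begin

(* Matrices live in the dynamically sized type 'a mat; sizes are imposed by carrier_mat. *)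

abbreviation cplx_mat :: "real mat \<Rightarrow> complex mat" where
  "cplx_mat \<equiv> map_mat complex_of_real"

(* Eigenvalues of a real matrix are its complex ones, hence the complexification. *)
definition schur_stable :: "real mat \<Rightarrow> bool" where
  "schur_stable A \<longleftrightarrow>
     square_mat A \<and> (\<forall>k. eigenvalue (cplx_mat A) k \<longrightarrow> cmod k < 1)"

definition psd :: "real mat \<Rightarrow> bool" where
  "psd M \<longleftrightarrow> square_mat M \<and> M\<^sup>T = M \<and>
     (\<forall>x \<in> carrier_vec (dim_row M). x \<bullet> (M *\<^sub>v x) \<ge> 0)"

definition pos_def :: "real mat \<Rightarrow> bool" where
  "pos_def M \<longleftrightarrow> square_mat M \<and> M\<^sup>T = M \<and>
     (\<forall>x \<in> carrier_vec (dim_row M). x \<noteq> 0\<^sub>v (dim_row M) \<longrightarrow> x \<bullet> (M *\<^sub>v x) > 0)"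

definition pos_diagonal :: "real mat \<Rightarrow> bool" where
  "pos_diagonal M \<longleftrightarrow> square_mat M \<and> diagonal_mat M \<and> (\<forall>i < dim_row M. M $$ (i, i) > 0)"

(* Total inverse, meaningful only for invertible matrices (see the lemma below). *)
definition inv_of :: "'a :: field mat \<Rightarrow> 'a mat" where
  "inv_of M = the (mat_inverse M)"

lemma inv_of_inverse:
  assumes M: "M \<in> carrier_mat n n" and inv: "invertible_mat M"
  shows "inv_of M \<in> carrier_mat n n" "M * inv_of M = 1\<^sub>m n" "inv_of M * M = 1\<^sub>m n"
proof -
  obtain B where B: "M * B = 1\<^sub>m n" "B * M = 1\<^sub>m (dim_row B)"
    using inv M unfolding invertible_mat_def inverts_mat_def by auto
  have "dim_col (M * B) = n" "dim_col (B * M) = dim_row B"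
    using B by (metis index_one_mat(3))+
  then have Bc: "B \<in> carrier_mat n n"
    using M by auto
  then have "M \<in> Units (ring_mat TYPE('a) n ())"
    using M B unfolding Units_def ring_mat_def by auto
  then obtain C where C: "mat_inverse M = Some C"
    using mat_inverse(1)[OF M, of "()"] by (cases "mat_inverse M") auto
  show "inv_of M \<in> carrier_mat n n" "M * inv_of M = 1\<^sub>m n" "inv_of M * M = 1\<^sub>m n"
    using mat_inverse(2)[OF M C] C unfolding inv_of_def by auto
qed

definition Sigma_KL :: "nat \<Rightarrow> nat \<Rightarrow> real mat \<Rightarrow> real mat \<Rightarrow> real mat \<Rightarrow> real mat \<Rightarrow>
    real mat \<Rightarrow> real mat \<Rightarrow> real mat \<Rightarrow> real mat \<Rightarrow> (real mat \<times> real mat) set" where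
  "Sigma_KL n m Am Bm DA DB GA GB K L =
     {(A, B). A \<in> carrier_mat n n \<and> B \<in> carrier_mat n m \<and>
        psd (DA - (A + B * K - Am) * GA * (A + B * K - Am)\<^sup>T) \<and>
        psd (DB - (B * L - Bm) * GB * (B * L - Bm)\<^sup>T)}"

definition Psi :: "real mat \<Rightarrow> real mat \<Rightarrow> real mat \<Rightarrow> real mat \<Rightarrow> complex \<Rightarrow> complex mat" where
  "Psi R11 R12 R21 R22 z =
     cplx_mat R11 + cplx_mat R22 + z \<cdot>\<^sub>m cplx_mat R12 + inverse z \<cdot>\<^sub>m cplx_mat R21"

end

(* The set of closed-loop matrices A + B K is { Am + X | X G X^T <= D }. If some real x violates the
   matrix inequality, put w = (Am^T - I) x; the rank-one X = - D x w^T / (x^T D x) is admissible by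
   Cauchy-Schwarz and gives Am + X the left eigenvector x for the eigenvalue 1.

   Conversely the inequality says that -Psi(1) is positive definite. The spectral hypothesis means, via
   the Cayley transform, that Psi is nonsingular on the unit circle, so by continuity the Hermitian
   matrix -Psi(z) stays positive definite for |z| = 1. With w = (Am^T - z) v one has
   v^* Psi(z) v = v^* D v - w^* G w, which excludes eigenvalues of modulus 1 for every Am + t X with
   0 <= t <= 1; since the spectrum moves continuously, Am + X is Schur because Am is. *)

theory Submission
  imports Defs "HOL-Analysis.Function_Topology" "HOL-Analysis.Topology_Euclidean_Space"
begin

unbundle no vec_syntax

section \<open>Continuity of the spectrum\<close>

text \<open>Neither the eigenvalues nor the minimum of a Hermitian form over the unit sphere comes
  with a convenient continuous parametrization, so both homotopies are argued through the first time
  in \<open>{0..1}\<close> at which a closed bad condition is met over a compact parameter set.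
  Before that time a weak inequality holds; it passes to the limit and there collides with the bad
  condition. For the spectrum this inequality has to be quantitative and uniform in time, because
  the mere absence of eigenvalues does not survive a limit. For the form, semidefiniteness suffices,
  since a semidefinite form vanishes only on its kernel.

  The constraint X G X^T <= D controls \<open>X\<^sup>T *\<^sub>v x\<close> in terms of x and says
  nothing as direct about \<open>X *\<^sub>v x\<close>; this is why eigenvalues of Am + X are
  witnessed by left eigenvectors. These may be complex while the hypotheses are real quadratic
  inequalities; splitting into real and imaginary parts bridges the two.\<close>

text \<open>The bad pairs form a closed subset of a compact product, so their projection to the time
  axis is compact and attains its minimum.\<close>

lemma first_hitting_time:
  fixes g :: "real \<times> 'b::topological_space \<Rightarrow> 'c::topological_space"
  assumes C: "compact C" and g: "continuous_on ({0..1} \<times> C) g" and T: "closed T"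
    and p: "s0 \<in> {0..1}" "y0 \<in> C" "g (s0, y0) \<in> T"
  shows "\<exists>t \<in> {0..1}. \<exists>x \<in> C. g (t, x) \<in> T \<and>
    (\<forall>s \<in> {0..1}. \<forall>y \<in> C. g (s, y) \<in> T \<longrightarrow> t \<le> s)"
proof -
  let ?S = "{0..1 :: real} \<times> C" and ?Z = "({0..1} \<times> C) \<inter> g -` T"
  have "closedin (top_of_set ?S) ?Z"
    by (rule continuous_closedin_preimage[OF g T])
  moreover have "compact ?S"
    using C by (intro compact_Times compact_Icc)
  ultimately have "compact ?Z"
    using closedin_compact by blast
  then have "compact (fst ` ?Z)"
    by (intro compact_continuous_image continuous_intros)
  moreover have "(s0, y0) \<in> ?Z" using p by auto
  then have "fst ` ?Z \<noteq> {}" by blast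
  ultimately obtain t where "t \<in> fst ` ?Z" "\<forall>s \<in> fst ` ?Z. t \<le> s"
    using compact_attains_inf by blast
  then show ?thesis by force
qed

lemma continuous_on_det:
  assumes "\<And>x. x \<in> S \<Longrightarrow> M x \<in> carrier_mat n n"
    and "\<And>i j. i < n \<Longrightarrow> j < n \<Longrightarrow> continuous_on S (\<lambda>x. M x $$ (i, j))"
  shows "continuous_on S (\<lambda>x. det (M x) :: complex)"
proof -
  have "continuous_on S (\<lambda>x. \<Sum>p \<in> {p. p permutes {0..<n}}.
      signof p * (\<Prod>i = 0..<n. M x $$ (i, p i)))"
    by (intro continuous_intros assms(2)) (auto simp: permutes_in_image)
  then show ?thesis
    by (rule continuous_on_cong[THEN iffD1, rotated 2]) (simp_all add: det_def'[OF assms(1)])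
qed

lemma smult_mat_mult_vec:
  fixes M :: "'a::comm_ring_1 mat"
  assumes "M \<in> carrier_mat nr nc" "v \<in> carrier_vec nc"
  shows "(c \<cdot>\<^sub>m M) *\<^sub>v v = c \<cdot>\<^sub>v (M *\<^sub>v v)"
  using assms by (intro eq_vecI) (auto simp: scalar_prod_def sum_distrib_left mult.assoc)

text \<open>Here u stands for the reciprocal of an eigenvalue. At u = 0, the point that represents
  infinity, the matrix is the identity, so adding this point compactifies the exterior of the disc
  without creating a spurious zero.\<close>

lemma det_resolvent_zero_iff:
  fixes A :: "complex mat"
  assumes A: "A \<in> carrier_mat n n"
  shows "det (1\<^sub>m n - u \<cdot>\<^sub>m A) = 0 \<longleftrightarrow> u \<noteq> 0 \<and> eigenvalue A (inverse u)"
proof -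
  let ?M = "1\<^sub>m n - u \<cdot>\<^sub>m A"
  have M: "?M \<in> carrier_mat n n" using A by auto
  have Mv: "?M *\<^sub>v v = v - u \<cdot>\<^sub>v (A *\<^sub>v v)" if v: "v \<in> carrier_vec n" for v
    using A v by (simp add: minus_mult_distrib_mat_vec[where nr = n and nc = n] smult_mat_mult_vec)
  have "?M *\<^sub>v v = 0\<^sub>v n \<longleftrightarrow> u \<noteq> 0 \<and> A *\<^sub>v v = inverse u \<cdot>\<^sub>v v"
    if v: "v \<in> carrier_vec n" "v \<noteq> 0\<^sub>v n" for v
  proof
    assume "?M *\<^sub>v v = 0\<^sub>v n"
    then have *: "v - u \<cdot>\<^sub>v (A *\<^sub>v v) = 0\<^sub>v n" using Mv[OF v(1)] by simp
    have e: "v $ i = u * (A *\<^sub>v v) $ i" if "i < n" for i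
      using arg_cong[OF *, of "\<lambda>x. x $ i"] that A v by simp
    have "u \<noteq> 0"
    proof
      assume "u = 0"
      then have "v = 0\<^sub>v n" using e v by (intro eq_vecI) auto
      then show False using v by simp
    qed
    moreover have "A *\<^sub>v v = inverse u \<cdot>\<^sub>v v"
      using A v e \<open>u \<noteq> 0\<close> by (intro eq_vecI) (auto simp: e)
    ultimately show "u \<noteq> 0 \<and> A *\<^sub>v v = inverse u \<cdot>\<^sub>v v" by simp
  next
    assume "u \<noteq> 0 \<and> A *\<^sub>v v = inverse u \<cdot>\<^sub>v v"
    then show "?M *\<^sub>v v = 0\<^sub>v n" using Mv[OF v(1)] v by (auto simp: smult_smult_assoc)
  qed
  then show ?thesis
    unfolding det_0_iff_vec_prod_zero[OF M] eigenvalue_def eigenvector_def using A by auto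
qed

text \<open>Each of the n linear factors has modulus at least \<open>cmod z - 1\<close>. The bound
  depends on A only through n, hence it is uniform along a path of matrices.\<close>

lemma char_poly_lower_bound:
  fixes A :: "complex mat"
  assumes A: "A \<in> carrier_mat n n" and ev: "\<And>k. eigenvalue A k \<Longrightarrow> cmod k < 1"
    and z: "1 \<le> cmod z"
  shows "(cmod z - 1) ^ n \<le> cmod (poly (char_poly A) z)"
proof -
  obtain as where as: "char_poly A = (\<Prod>a\<leftarrow>as. [:- a, 1:])" "length as = n"
    using char_poly_factorized[OF A] by blast
  have "cmod a < 1" if "a \<in> set as" for a
  proof (rule ev)
    have "poly (\<Prod>a\<leftarrow>as. [:- a, 1:]) a = 0"
      using that by (induction as) auto
    then show "eigenvalue A a"
      using eigenvalue_root_char_poly[OF A] as by simp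
  qed
  then have "(cmod z - 1) ^ length as \<le> cmod (poly (\<Prod>a\<leftarrow>as. [:- a, 1:]) z)"
  proof (induction as)
    case (Cons a as)
    have "cmod z - 1 \<le> cmod (z - a)"
      using Cons.prems[of a] norm_triangle_ineq2[of z a] by simp
    then have "(cmod z - 1) * (cmod z - 1) ^ length as
        \<le> cmod (z - a) * cmod (poly (\<Prod>a\<leftarrow>as. [:- a, 1:]) z)"
      using Cons z by (intro mult_mono) auto
    then show ?case by (simp add: norm_mult algebra_simps flip: norm_mult)
  qed simp
  then show ?thesis using as by simp
qed

text \<open>At the first time at which some eigenvalue z lies outside the open disc, z is off the
  circle, so \<open>1 < cmod z\<close>. At all earlier times the characteristic polynomial at this
  fixed z has modulus at least \<open>(cmod z - 1) ^ n\<close>, and by continuity it cannot drop to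
  0 at that time.\<close>

lemma spectrum_homotopy:
  fixes A :: "real \<Rightarrow> complex mat"
  assumes A: "\<And>t. A t \<in> carrier_mat n n"
    and cont: "\<And>i j. i < n \<Longrightarrow> j < n \<Longrightarrow> continuous_on {0..1} (\<lambda>t. A t $$ (i, j))"
    and circle: "\<And>t k. t \<in> {0..1} \<Longrightarrow> eigenvalue (A t) k \<Longrightarrow> cmod k \<noteq> 1"
    and start: "\<And>k. eigenvalue (A 0) k \<Longrightarrow> cmod k < 1"
    and k: "eigenvalue (A 1) k"
  shows "cmod k < 1"
proof (rule ccontr)
  assume "\<not> cmod k < 1"
  then have k1: "1 \<le> cmod k" by simp
  \<comment> \<open>Eigenvalues outside the open disc enter as reciprocals, so that they range over a compact set.\<close>
  define g where "g = (\<lambda>(t, u). det (1\<^sub>m n - u \<cdot>\<^sub>m A t))"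
  have g0: "g (t, u) \<in> {0} \<longleftrightarrow> u \<noteq> 0 \<and> eigenvalue (A t) (inverse u)" for t u
    using det_resolvent_zero_iff[OF A] by (simp add: g_def)
  have g: "continuous_on ({0..1} \<times> cball 0 1) g"
    unfolding g_def case_prod_unfold
  proof (rule continuous_on_det)
    fix i j assume ij: "i < n" "j < n"
    have "continuous_on ({0..1} \<times> cball 0 1) (\<lambda>x. A (fst x) $$ (i, j))"
      by (rule continuous_on_compose2[OF cont[OF ij] continuous_on_fst[OF continuous_on_id]]) auto
    then have "continuous_on ({0..1} \<times> cball 0 1)
        (\<lambda>x. 1\<^sub>m n $$ (i, j) - snd x * A (fst x) $$ (i, j))"
      by (intro continuous_intros)
    then show "continuous_on ({0..1} \<times> cball 0 1)
        (\<lambda>x. (1\<^sub>m n - snd x \<cdot>\<^sub>m A (fst x)) $$ (i, j))"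
      using ij A by (simp add: carrier_matD[OF A])
  qed (intro minus_carrier_mat smult_carrier_mat A)
  have k: "inverse k \<in> cball 0 1" "g (1, inverse k) \<in> {0}"
    using k1 k unfolding g0 by (auto simp: dist_norm norm_inverse inverse_le_1_iff)
  have "\<exists>t \<in> {0..1}. \<exists>u \<in> cball 0 1. g (t, u) \<in> {0} \<and>
      (\<forall>s \<in> {0..1}. \<forall>y \<in> cball 0 1. g (s, y) \<in> {0} \<longrightarrow> t \<le> s)"
    by (rule first_hitting_time[OF compact_cball g _ _ k]) simp_all
  then obtain t u where t: "t \<in> {0..1}" and u: "u \<in> cball 0 1" and gtu: "g (t, u) \<in> {0}"
    and min: "\<forall>s \<in> {0..1}. \<forall>y \<in> cball 0 1. g (s, y) \<in> {0} \<longrightarrow> t \<le> s"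
    by blast
  have ev: "u \<noteq> 0" "eigenvalue (A t) (inverse u)" using gtu g0 by auto
  define z where "z = inverse u"
  have "cmod z \<noteq> 1" using circle[OF t] ev z_def by blast
  moreover have "1 \<le> cmod z"
    using u ev by (simp add: z_def norm_inverse one_le_inverse dist_norm)
  ultimately have z: "1 < cmod z" by simp
  have "t \<noteq> 0" using start ev z unfolding z_def by fastforce
  then have "0 < t" using t by simp
  have before: "(cmod z - 1) ^ n \<le> cmod (poly (char_poly (A s)) z)" if s: "s \<in> {0..<t}" for s
  proof (rule char_poly_lower_bound[OF A])
    fix l assume l: "eigenvalue (A s) l"
    show "cmod l < 1"
    proof (rule ccontr)
      assume "\<not> cmod l < 1"
      then have "inverse l \<in> cball 0 1" "g (s, inverse l) \<in> {0}"
        using l unfolding g0 by (auto simp: dist_norm norm_inverse inverse_le_1_iff)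
      moreover have "s \<in> {0..1}" "s < t" using s t by auto
      ultimately show False using min by (meson not_le)
    qed
  qed (use z in simp)
  \<comment> \<open>The value of the characteristic polynomial at z is a determinant whose entries
    are affine in those of \<open>A s\<close>, so it inherits their continuity.\<close>
  have "continuous_on {0..1} (\<lambda>s. cmod (det (- char_matrix (A s) z)))"
  proof (intro continuous_on_norm continuous_on_det)
    fix i j assume ij: "i < n" "j < n"
    have "continuous_on {0..1} (\<lambda>s. - (A s $$ (i, j) - z * 1\<^sub>m n $$ (i, j)))"
      by (intro continuous_intros cont ij)
    then show "continuous_on {0..1} (\<lambda>s. (- char_matrix (A s) z) $$ (i, j))"
      using ij by (simp add: char_matrix_def carrier_matD[OF A])
  qed (use A in auto)
  then have "continuous_on {0..1} (\<lambda>s. cmod (poly (char_poly (A s)) z))"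
    using char_poly_matrix[OF A] by simp
  then have "continuous_on (closure {0..<t}) (\<lambda>s. cmod (poly (char_poly (A s)) z))"
    using \<open>0 < t\<close> t by (auto elim: continuous_on_subset)
  from continuous_ge_on_closure[OF this _ before, of t]
  have "(cmod z - 1) ^ n \<le> cmod (poly (char_poly (A t)) z)"
    using \<open>0 < t\<close> by auto
  moreover have "poly (char_poly (A t)) z = 0"
    using ev eigenvalue_root_char_poly[OF A] by (simp add: z_def)
  moreover have "0 < (cmod z - 1) ^ n" using z by simp
  ultimately show False by simp
qed

section \<open>Hermitian forms\<close>

abbreviation sform :: "complex mat \<Rightarrow> complex Matrix.vec \<Rightarrow> complex Matrix.vec \<Rightarrow> complex" where
  "sform M v w \<equiv> (M *\<^sub>v v) \<bullet>c w"

lemma sform_sum: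
  assumes "M \<in> carrier_mat n n" "v \<in> carrier_vec n" "w \<in> carrier_vec n"
  shows "sform M v w = (\<Sum>i = 0..<n. \<Sum>j = 0..<n. M $$ (i, j) * v $ j * cnj (w $ i))"
  using assms by (simp add: scalar_prod_def sum_distrib_right)

lemma sform_add_smult:
  assumes M: "M \<in> carrier_mat n n" and v: "v \<in> carrier_vec n" and u: "u \<in> carrier_vec n"
  shows "sform M (v + a \<cdot>\<^sub>v u) (v + a \<cdot>\<^sub>v u) =
    sform M v v + cnj a * sform M v u + a * sform M u v + a * cnj a * sform M u u"
proof -
  have "v + a \<cdot>\<^sub>v u \<in> carrier_vec n" using v u by auto
  then show ?thesis
    using v u
    by (simp add: sform_sum[OF M] sum.distrib sum_distrib_left algebra_simps)
qed

lemma sform_smult: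
  assumes M: "M \<in> carrier_mat n n" and v: "v \<in> carrier_vec n"
  shows "Re (sform M (a \<cdot>\<^sub>v v) (a \<cdot>\<^sub>v v)) = (cmod a)\<^sup>2 * Re (sform M v v)"
proof -
  have "sform M (a \<cdot>\<^sub>v v) (a \<cdot>\<^sub>v v) = (a * cnj a) * sform M v v"
    using v by (simp add: sform_sum[OF M] sum_distrib_left algebra_simps)
  then show ?thesis
    by (simp only: complex_norm_square[symmetric]) simp
qed

lemma sform_hermitian:
  assumes M: "M \<in> carrier_mat n n" and v: "v \<in> carrier_vec n" and w: "w \<in> carrier_vec n"
    and herm: "\<And>i j. i < n \<Longrightarrow> j < n \<Longrightarrow> M $$ (j, i) = cnj (M $$ (i, j))"
  shows "sform M w v = cnj (sform M v w)"
proof -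
  have "sform M w v = (\<Sum>i = 0..<n. \<Sum>j = 0..<n. M $$ (i, j) * w $ j * cnj (v $ i))"
    by (rule sform_sum[OF M w v])
  also have "\<dots> = (\<Sum>j = 0..<n. \<Sum>i = 0..<n. M $$ (i, j) * w $ j * cnj (v $ i))"
    by (rule sum.swap)
  also have "\<dots> = cnj (sform M v w)"
    unfolding sform_sum[OF M v w] cnj_sum
  proof (intro sum.cong refl)
    fix i j assume "i \<in> {0..<n}" "j \<in> {0..<n}"
    then have "M $$ (j, i) = cnj (M $$ (i, j))" using herm[of i j] by simp
    then show "M $$ (j, i) * w $ i * cnj (v $ j) = cnj (M $$ (i, j) * v $ j * cnj (w $ i))"
      by simp
  qed
  finally show ?thesis .
qed

lemma cscalar_self: "v \<in> carrier_vec n \<Longrightarrow> v \<bullet>c v = of_real (\<Sum>i = 0..<n. (cmod (v $ i))\<^sup>2)"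
  by (simp add: scalar_prod_def complex_norm_square del: of_real_power)

text \<open>At v the form attains its minimum 0, so its derivative in the direction
  \<open>M *\<^sub>v v\<close> vanishes; that derivative is twice the squared norm of
  \<open>M *\<^sub>v v\<close>.\<close>

lemma psd_form_kernel:
  assumes M: "M \<in> carrier_mat n n" and v: "v \<in> carrier_vec n"
    and herm: "\<And>i j. i < n \<Longrightarrow> j < n \<Longrightarrow> M $$ (j, i) = cnj (M $$ (i, j))"
    and psd: "\<And>u. u \<in> carrier_vec n \<Longrightarrow> 0 \<le> Re (sform M u u)"
    and zero: "Re (sform M v v) \<le> 0"
  shows "M *\<^sub>v v = 0\<^sub>v n"
proof -
  define u where "u = M *\<^sub>v v"
  have u: "u \<in> carrier_vec n" using M v by (simp add: u_def)
  define N q where "N = (\<Sum>i = 0..<n. (cmod (u $ i))\<^sup>2)" and "q = Re (sform M u u)"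
  have vu: "sform M v u = of_real N"
    using cscalar_self[OF u] by (simp add: N_def u_def)
  then have uv: "sform M u v = of_real N"
    using sform_hermitian[OF M v u herm] by simp
  have q: "0 \<le> q" unfolding q_def by (rule psd[OF u])
  have quad: "0 \<le> 2 * e * N + e\<^sup>2 * q" for e :: real
  proof -
    have "0 \<le> Re (sform M (v + of_real e \<cdot>\<^sub>v u) (v + of_real e \<cdot>\<^sub>v u))"
      using u v by (intro psd) auto
    also have "\<dots> = Re (sform M v v) + 2 * e * N + e\<^sup>2 * q"
      unfolding sform_add_smult[OF M v u] vu uv q_def by (simp add: power2_eq_square algebra_simps)
    finally show ?thesis using zero by simp
  qed
  have "N \<le> 0"
  proof (rule ccontr)
    assume "\<not> N \<le> 0"
    then have N: "0 < N" by simp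
    \<comment> \<open>The step -c makes the linear term dominate the quadratic one; the added 1
      keeps the denominator positive when q = 0.\<close>
    define c where "c = N / (q + 1)"
    have "0 < c" and Nc: "N = c * (q + 1)" using q N by (auto simp: c_def)
    have "0 \<le> 2 * (- c) * N + (- c)\<^sup>2 * q" by (rule quad)
    also have "\<dots> = - (c\<^sup>2 * (q + 2))"
      unfolding Nc by (simp add: power2_eq_square algebra_simps)
    also have "\<dots> < 0"
      using q \<open>0 < c\<close> by simp
    finally show False by simp
  qed
  moreover have "0 \<le> N" unfolding N_def by (intro sum_nonneg) auto
  ultimately have "u \<bullet>c u = 0" using cscalar_self[OF u] by (simp add: N_def)
  then have "u = 0\<^sub>v n" using conjugate_square_eq_0_vec[OF u] by simp
  then show ?thesis by (simp add: u_def)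
qed

text \<open>At the first time at which a unit vector x has a nonpositive value, the form is still
  semidefinite as a limit of semidefinite forms. Hence x lies in the kernel, against
  nonsingularity.\<close>

lemma definite_homotopy:
  fixes H :: "real \<Rightarrow> complex mat"
  assumes H: "\<And>t. H t \<in> carrier_mat n n"
    and cont: "\<And>i j. i < n \<Longrightarrow> j < n \<Longrightarrow> continuous_on {0..1} (\<lambda>t. H t $$ (i, j))"
    and herm: "\<And>t i j. i < n \<Longrightarrow> j < n \<Longrightarrow> H t $$ (j, i) = cnj (H t $$ (i, j))"
    and nonsing: "\<And>t v. t \<in> {0..1} \<Longrightarrow> v \<in> carrier_vec n \<Longrightarrow> H t *\<^sub>v v = 0\<^sub>v n \<Longrightarrow> v = 0\<^sub>v n"
    and start: "\<And>v. v \<in> carrier_vec n \<Longrightarrow> v \<noteq> 0\<^sub>v n \<Longrightarrow> 0 < Re (sform (H 0) v v)"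
    and v: "v \<in> carrier_vec n" "v \<noteq> 0\<^sub>v n"
  shows "0 < Re (sform (H 1) v v)"
proof (rule ccontr)
  assume neg: "\<not> 0 < Re (sform (H 1) v v)"
  \<comment> \<open>Vectors are taken as functions on all of \<^typ>\<open>nat\<close>, where Tychonoff's theorem gives compactness.\<close>
  define C where "C = PiE UNIV (\<lambda>i::nat. cball (0::complex) 1)"
  have C: "compact C"
  proof -
    have "compactin (product_topology (\<lambda>i. euclidean) UNIV) C"
      unfolding C_def compactin_PiE by simp
    then show ?thesis unfolding euclidean_product_topology by simp
  qed
  \<comment> \<open>The second component is the squared norm of the first n coordinates. Membership
    in \<open>T\<close> thus says that the form is nonpositive at a unit vector, which keeps the
    zero vector out of the closed condition.\<close>
  define g where "g = (\<lambda>(t, f). (Re (sform (H t) (Matrix.vec n f) (Matrix.vec n f)),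
    \<Sum>i = 0..<n. (cmod (f i))\<^sup>2))"
  define T where "T = {..0::real} \<times> {1::real}"
  have T: "closed T" by (simp add: T_def closed_Times)
  have g: "continuous_on ({0..1} \<times> C) g"
  proof -
    have H': "continuous_on ({0..1} \<times> C) (\<lambda>x. H (fst x) $$ (i, j))" if "i < n" "j < n" for i j
      by (rule continuous_on_compose2[OF cont[OF that] continuous_on_fst[OF continuous_on_id]]) auto
    have f': "continuous_on ({0..1} \<times> C) (\<lambda>x. snd x i)" for i
      by (rule continuous_on_compose2[OF continuous_on_product_coordinates[of i]
            continuous_on_snd[OF continuous_on_id]]) simp
    have "continuous_on ({0..1} \<times> C) (\<lambda>x. (Re (\<Sum>i = 0..<n. \<Sum>j = 0..<n.
        H (fst x) $$ (i, j) * snd x j * cnj (snd x i)), \<Sum>i = 0..<n. (cmod (snd x i))\<^sup>2))"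
      by (intro continuous_intros H' f') auto
    then show ?thesis
      by (simp add: g_def case_prod_unfold sform_sum[OF H])
  qed
  have small: "f \<in> C" if "(\<Sum>i = 0..<n. (cmod (f i))\<^sup>2) = 1" "\<And>i. n \<le> i \<Longrightarrow> f i = 0" for f
  proof -
    have "cmod (f i) \<le> 1" for i
    proof (cases "i < n")
      case True
      then have "(cmod (f i))\<^sup>2 \<le> (\<Sum>i = 0..<n. (cmod (f i))\<^sup>2)"
        by (intro member_le_sum) auto
      then show ?thesis using that(1) abs_square_le_1[of "cmod (f i)"] by simp
    qed (use that in simp)
    then show ?thesis by (simp add: C_def PiE_UNIV_domain)
  qed
  have normalize: "\<exists>f \<in> C. g (t, f) \<in> T"
    if w: "w \<in> carrier_vec n" "w \<noteq> 0\<^sub>v n" and neg: "\<not> 0 < Re (sform (H t) w w)" for t w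
  proof -
    define N where "N = (\<Sum>i = 0..<n. (cmod (w $ i))\<^sup>2)"
    have "w \<bullet>c w = of_real N" unfolding N_def by (rule cscalar_self[OF w(1)])
    then have "N \<noteq> 0"
      using w conjugate_square_eq_0_vec[OF w(1)] by auto
    moreover have "0 \<le> N" unfolding N_def by (intro sum_nonneg) auto
    ultimately have N: "0 < N" by simp
    define c where "c = complex_of_real (inverse (sqrt N))"
    have c2: "(cmod c)\<^sup>2 = inverse N"
      using N by (simp add: c_def norm_inverse power_inverse)
    \<comment> \<open>Normalizing w bounds the first n coordinates by 1, and the padding by 0 keeps
      all others in the box \<open>C\<close>.\<close>
    define f where "f i = (if i < n then c * w $ i else 0)" for i
    have vf: "Matrix.vec n f = c \<cdot>\<^sub>v w"
      using w by (intro eq_vecI) (auto simp: f_def)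
    have "(\<Sum>i = 0..<n. (cmod (f i))\<^sup>2) = (\<Sum>i = 0..<n. (cmod c)\<^sup>2 * (cmod (w $ i))\<^sup>2)"
      by (intro sum.cong) (auto simp: f_def norm_mult power_mult_distrib)
    also have "\<dots> = 1"
      using N unfolding sum_distrib_left[symmetric] N_def[symmetric] c2 by simp
    finally have f1: "(\<Sum>i = 0..<n. (cmod (f i))\<^sup>2) = 1" .
    have "Re (sform (H t) (Matrix.vec n f) (Matrix.vec n f)) \<le> 0"
      unfolding vf sform_smult[OF H w(1)] using neg by (intro mult_nonneg_nonpos) auto
    then have "g (t, f) \<in> T" using f1 by (simp add: g_def T_def)
    moreover have "f \<in> C" by (rule small[OF f1]) (simp add: f_def)
    ultimately show ?thesis by blast
  qed
  obtain f0 where f0: "f0 \<in> C" "g (1, f0) \<in> T"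
    using normalize[OF v neg] by blast
  have "\<exists>t \<in> {0..1}. \<exists>f \<in> C. g (t, f) \<in> T \<and>
      (\<forall>s \<in> {0..1}. \<forall>y \<in> C. g (s, y) \<in> T \<longrightarrow> t \<le> s)"
    by (rule first_hitting_time[OF C g T _ f0]) simp
  then obtain t f where t: "t \<in> {0..1}" and gtf: "g (t, f) \<in> T"
    and min: "\<forall>s \<in> {0..1}. \<forall>y \<in> C. g (s, y) \<in> T \<longrightarrow> t \<le> s"
    by blast
  define x where "x = Matrix.vec n f"
  have x: "x \<in> carrier_vec n" by (simp add: x_def)
  have xneg: "Re (sform (H t) x x) \<le> 0" and x1: "(\<Sum>i = 0..<n. (cmod (f i))\<^sup>2) = 1"
    using gtf by (auto simp: g_def x_def T_def)
  have x0: "x \<noteq> 0\<^sub>v n"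
  proof
    assume "x = 0\<^sub>v n"
    then have "x $ i = 0" if "i < n" for i
      using that by simp
    then have "f i = 0" if "i < n" for i
      using that by (simp add: x_def)
    then show False using x1 by simp
  qed
  have "t \<noteq> 0" using start[OF x x0] xneg by auto
  then have "0 < t" using t by simp
  have pos: "0 \<le> Re (sform (H s) u u)" if s: "s \<in> {0..<t}" and u: "u \<in> carrier_vec n" for s u
  proof (cases "u = 0\<^sub>v n")
    case True
    then show ?thesis unfolding sform_sum[OF H u u] by simp
  next
    case False
    show ?thesis
    proof (rule ccontr)
      assume "\<not> 0 \<le> Re (sform (H s) u u)"
      then have "\<not> 0 < Re (sform (H s) u u)" by linarith
      from normalize[OF u False this] obtain f where "f \<in> C" "g (s, f) \<in> T"
        by blast
      moreover have "s \<in> {0..1}" "s < t" using s t by auto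
      ultimately show False using min by (meson not_le)
    qed
  qed
  have psd: "0 \<le> Re (sform (H t) u u)" if u: "u \<in> carrier_vec n" for u
  proof -
    have "continuous_on {0..1} (\<lambda>s. Re (\<Sum>i = 0..<n. \<Sum>j = 0..<n. H s $$ (i, j) * u $ j * cnj (u $ i)))"
      by (intro continuous_intros cont) auto
    then have "continuous_on {0..1} (\<lambda>s. Re (sform (H s) u u))"
      by (simp add: sform_sum[OF H u u])
    then have "continuous_on (closure {0..<t}) (\<lambda>s. Re (sform (H s) u u))"
      using \<open>0 < t\<close> t by (auto elim: continuous_on_subset)
    from continuous_ge_on_closure[OF this _ pos[OF _ u], of t]
    show ?thesis using \<open>0 < t\<close> by auto
  qed
  have "H t *\<^sub>v x = 0\<^sub>v n"
    by (rule psd_form_kernel[OF H x herm psd xneg])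
  then show False using nonsing[OF t x] x0 by simp
qed

section \<open>Real quadratic forms\<close>

lemma cplx_mult_mat_vec:
  assumes "M \<in> carrier_mat nr nc" "v \<in> carrier_vec nc"
  shows "map_vec Re (cplx_mat M *\<^sub>v v) = M *\<^sub>v map_vec Re v"
    and "map_vec Im (cplx_mat M *\<^sub>v v) = M *\<^sub>v map_vec Im v"
  using assms by (auto intro!: eq_vecI simp: scalar_prod_def Re_sum Im_sum)

text \<open>For a real matrix the products of a real part with an imaginary part contribute only to
  the imaginary part of the form. Real quadratic inequalities thereby transfer to complex
  vectors.\<close>

lemma sform_real:
  assumes M: "M \<in> carrier_mat n n" and v: "v \<in> carrier_vec n"
  shows "Re (sform (cplx_mat M) v v) =
    map_vec Re v \<bullet> (M *\<^sub>v map_vec Re v) + map_vec Im v \<bullet> (M *\<^sub>v map_vec Im v)"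
proof -
  have "Re (sform (cplx_mat M) v v) = (\<Sum>i = 0..<n. \<Sum>j = 0..<n.
      Re (v $ i) * (M $$ (i, j) * Re (v $ j)) + Im (v $ i) * (M $$ (i, j) * Im (v $ j)))"
    using M v by (subst sform_sum[of _ n]) (auto simp: Re_sum algebra_simps intro!: sum.cong)
  also have "\<dots> = map_vec Re v \<bullet> (M *\<^sub>v map_vec Re v) + map_vec Im v \<bullet> (M *\<^sub>v map_vec Im v)"
    using M v by (simp add: scalar_prod_def sum.distrib sum_distrib_left)
  finally show ?thesis .
qed

lemma sform_cplx_adjoint:
  assumes M: "M \<in> carrier_mat n n" and v: "v \<in> carrier_vec n" and w: "w \<in> carrier_vec n"
  shows "sform (cplx_mat M) v w = v \<bullet>c (cplx_mat M\<^sup>T *\<^sub>v w)"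
proof -
  have "sform (cplx_mat M) v w = (\<Sum>i = 0..<n. \<Sum>j = 0..<n. M $$ (i, j) * v $ j * cnj (w $ i))"
    using M v w by (subst sform_sum[of _ n]) auto
  also have "\<dots> = (\<Sum>j = 0..<n. \<Sum>i = 0..<n. M $$ (i, j) * v $ j * cnj (w $ i))"
    by (rule sum.swap)
  also have "\<dots> = v \<bullet>c (cplx_mat M\<^sup>T *\<^sub>v w)"
    using M v w by (simp add: scalar_prod_def sum_distrib_left mult_ac)
  finally show ?thesis .
qed

lemma map_vec_Re_Im_zero:
  assumes "v \<in> carrier_vec n" "v \<noteq> 0\<^sub>v n"
  shows "map_vec Re v \<noteq> 0\<^sub>v n \<or> map_vec Im v \<noteq> 0\<^sub>v n"
proof (rule ccontr)
  assume "\<not> ?thesis"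
  then have R: "map_vec Re v = 0\<^sub>v n" and I: "map_vec Im v = 0\<^sub>v n" by auto
  have "v $ i = 0" if "i < n" for i
    using that arg_cong[OF R, of "\<lambda>x. x $ i"] arg_cong[OF I, of "\<lambda>x. x $ i"] assms(1)
    by (simp add: complex_eq_iff)
  then have "v = 0\<^sub>v n" using assms(1) by (intro eq_vecI) auto
  then show False using assms(2) by simp
qed

lemma real_form_add_smult:
  fixes M :: "real mat"
  assumes M: "M \<in> carrier_mat n n" "M\<^sup>T = M" and x: "x \<in> carrier_vec n" and y: "y \<in> carrier_vec n"
  shows "(x + s \<cdot>\<^sub>v y) \<bullet> (M *\<^sub>v (x + s \<cdot>\<^sub>v y)) =
    x \<bullet> (M *\<^sub>v x) + 2 * s * (x \<bullet> (M *\<^sub>v y)) + s\<^sup>2 * (y \<bullet> (M *\<^sub>v y))"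
proof -
  have "M *\<^sub>v (x + s \<cdot>\<^sub>v y) = M *\<^sub>v x + s \<cdot>\<^sub>v (M *\<^sub>v y)"
    using M x y by (simp add: mult_add_distrib_mat_vec mult_mat_vec)
  moreover have "y \<bullet> (M *\<^sub>v x) = x \<bullet> (M *\<^sub>v y)"
    using transpose_vec_mult_scalar[OF M(1) x y] M x y
    by (metis comm_scalar_prod mult_mat_vec_carrier)
  ultimately show ?thesis
    using M x y
    by (simp add: add_scalar_prod_distrib[of _ n] scalar_prod_add_distrib[of _ n]
        power2_eq_square algebra_simps)
qed

text \<open>The form may be degenerate, so positivity is asked only at the vector y whose value is
  the divisor.\<close>

lemma psd_Cauchy_Schwarz:
  fixes M :: "real mat"
  assumes M: "M \<in> carrier_mat n n" "psd M" and x: "x \<in> carrier_vec n" and y: "y \<in> carrier_vec n"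
    and d: "0 < y \<bullet> (M *\<^sub>v y)"
  shows "(x \<bullet> (M *\<^sub>v y))\<^sup>2 / (y \<bullet> (M *\<^sub>v y)) \<le> x \<bullet> (M *\<^sub>v x)"
proof -
  define d c where "d = y \<bullet> (M *\<^sub>v y)" and "c = x \<bullet> (M *\<^sub>v y)"
  have sym: "M\<^sup>T = M" using M by (simp add: psd_def)
  \<comment> \<open>The coefficient -c / d minimizes the quadratic polynomial s \<mapsto> form at x
    + s y.\<close>
  have "0 \<le> (x + (- c / d) \<cdot>\<^sub>v y) \<bullet> (M *\<^sub>v (x + (- c / d) \<cdot>\<^sub>v y))"
    using M x y by (auto simp: psd_def)
  also have "\<dots> = x \<bullet> (M *\<^sub>v x) - c\<^sup>2 / d"
    unfolding real_form_add_smult[OF M(1) sym x y]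
    using d by (simp flip: c_def d_def add: field_simps power2_eq_square)
  finally show ?thesis by (simp add: c_def d_def)
qed

lemma pos_diagonal_form_pos:
  assumes M: "M \<in> carrier_mat n n" "pos_diagonal M" and x: "x \<in> carrier_vec n" "x \<noteq> 0\<^sub>v n"
  shows "0 < x \<bullet> (M *\<^sub>v x)"
proof -
  have "(M *\<^sub>v x) $ i = M $$ (i, i) * x $ i" if i: "i < n" for i
  proof -
    have "(M *\<^sub>v x) $ i = (\<Sum>j = 0..<n. M $$ (i, j) * x $ j)"
      using M x i by (simp add: scalar_prod_def)
    also have "\<dots> = (\<Sum>j = 0..<n. if j = i then M $$ (i, i) * x $ i else 0)"
      using M i by (intro sum.cong) (auto simp: pos_diagonal_def diagonal_mat_def)
    also have "\<dots> = M $$ (i, i) * x $ i" using i by simp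
    finally show ?thesis .
  qed
  then have eq: "x \<bullet> (M *\<^sub>v x) = (\<Sum>i = 0..<n. M $$ (i, i) * (x $ i)\<^sup>2)"
    using M x by (auto simp: scalar_prod_def power2_eq_square intro!: sum.cong)
  obtain i where "i < n" "x $ i \<noteq> 0"
    using x by (metis carrier_vecD eq_vecI index_zero_vec(1) index_zero_vec(2))
  then show ?thesis
    unfolding eq using M
    by (intro sum_pos2[of _ i]) (auto simp: pos_diagonal_def less_imp_le)
qed

lemma pos_diagonal_symmetric:
  assumes "pos_diagonal M"
  shows "M\<^sup>T = M"
proof (rule eq_matI)
  fix i j assume "i < dim_row M" "j < dim_col M"
  then show "M\<^sup>T $$ (i, j) = M $$ (i, j)"
    using assms by (cases "i = j") (auto simp: pos_diagonal_def diagonal_mat_def)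
qed (use assms in \<open>auto simp: pos_diagonal_def\<close>)

lemma transpose_eq_index:
  assumes "M\<^sup>T = N" "M \<in> carrier_mat n n" "i < n" "j < n"
  shows "M $$ (j, i) = N $$ (i, j)"
  using assms by auto

section \<open>Congruences and block products as pointwise inequalities\<close>

lemma congruence_form:
  fixes M :: "real mat"
  assumes M: "M \<in> carrier_mat n n" and X: "X \<in> carrier_mat k n" and x: "x \<in> carrier_vec k"
  shows "x \<bullet> ((X * M * X\<^sup>T) *\<^sub>v x) = (X\<^sup>T *\<^sub>v x) \<bullet> (M *\<^sub>v (X\<^sup>T *\<^sub>v x))"
proof -
  have "(X * M * X\<^sup>T) *\<^sub>v x = X *\<^sub>v (M *\<^sub>v (X\<^sup>T *\<^sub>v x))"
    using M X x by (simp add: assoc_mult_mat_vec[of _ k n] assoc_mult_mat_vec[of _ k n _ k])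
  then show ?thesis
    using transpose_vec_mult_scalar[OF X _ x] M X x by simp
qed

lemma congruence_symmetric:
  fixes M :: "real mat"
  assumes M: "M \<in> carrier_mat n n" "M\<^sup>T = M" and X: "X \<in> carrier_mat k n"
  shows "(X * M * X\<^sup>T)\<^sup>T = X * M * X\<^sup>T"
proof -
  have "(X * M * X\<^sup>T)\<^sup>T = X * (X * M)\<^sup>T"
    using M X by (subst transpose_mult[of _ k n]) auto
  also have "(X * M)\<^sup>T = M * X\<^sup>T"
    using M X by (subst transpose_mult[of _ k n]) auto
  finally show ?thesis
    using M X by (simp add: assoc_mult_mat[of _ k n _ n _ k])
qed

lemma psd_diff_congruence_iff:
  fixes M :: "real mat"
  assumes D: "D \<in> carrier_mat n n" "D\<^sup>T = D" and M: "M \<in> carrier_mat n n" "M\<^sup>T = M"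
    and X: "X \<in> carrier_mat n n"
  shows "psd (D - X * M * X\<^sup>T) \<longleftrightarrow>
    (\<forall>x \<in> carrier_vec n. (X\<^sup>T *\<^sub>v x) \<bullet> (M *\<^sub>v (X\<^sup>T *\<^sub>v x)) \<le> x \<bullet> (D *\<^sub>v x))"
proof -
  have XMX: "X * M * X\<^sup>T \<in> carrier_mat n n" using M X by auto
  have "x \<bullet> ((D - X * M * X\<^sup>T) *\<^sub>v x) =
      x \<bullet> (D *\<^sub>v x) - (X\<^sup>T *\<^sub>v x) \<bullet> (M *\<^sub>v (X\<^sup>T *\<^sub>v x))" if x: "x \<in> carrier_vec n" for x
    using D XMX x congruence_form[OF M(1) X x]
    by (simp add: minus_mult_distrib_mat_vec[OF D(1) XMX x] scalar_prod_minus_distrib[OF x])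
  moreover have "(D - X * M * X\<^sup>T)\<^sup>T = D - X * M * X\<^sup>T"
    using D XMX congruence_symmetric[OF M X] by (simp add: transpose_minus[OF D(1) XMX])
  ultimately show ?thesis
    using D XMX unfolding psd_def by auto
qed

text \<open>The stacked factor sends x to the pair (x, X x), on which the block-diagonal form is the
  difference of the two real forms.\<close>

lemma pos_def_lmi_iff:
  fixes D G X :: "real mat"
  assumes D: "D \<in> carrier_mat n n" "D\<^sup>T = D" and G: "G \<in> carrier_mat n n" "G\<^sup>T = G"
    and X: "X \<in> carrier_mat n n"
  shows "pos_def ((1\<^sub>m n @\<^sub>r X)\<^sup>T * four_block_mat (- D) (0\<^sub>m n n) (0\<^sub>m n n) G * (1\<^sub>m n @\<^sub>r X)) \<longleftrightarrow>
    (\<forall>x \<in> carrier_vec n. x \<noteq> 0\<^sub>v n \<longrightarrow> x \<bullet> (D *\<^sub>v x) < (X *\<^sub>v x) \<bullet> (G *\<^sub>v (X *\<^sub>v x)))"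
proof -
  define E F where "E = 1\<^sub>m n @\<^sub>r X" and "F = four_block_mat (- D) (0\<^sub>m n n) (0\<^sub>m n n) G"
  have E: "E \<in> carrier_mat (n + n) n" using X by (simp add: E_def)
  have F: "F \<in> carrier_mat (n + n) (n + n)" using D G by (simp add: F_def)
  have "F\<^sup>T = F"
    unfolding F_def using D G by (subst transpose_four_block_mat[of _ n n _ n _ n]) (auto simp: transpose_uminus)
  then have sym: "(E\<^sup>T * F * E)\<^sup>T = E\<^sup>T * F * E"
    using congruence_symmetric[OF F, of "E\<^sup>T" n] E by simp
  have form: "x \<bullet> ((E\<^sup>T * F * E) *\<^sub>v x) = (X *\<^sub>v x) \<bullet> (G *\<^sub>v (X *\<^sub>v x)) - x \<bullet> (D *\<^sub>v x)"
    if x: "x \<in> carrier_vec n" for x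
  proof -
    have Ex: "E *\<^sub>v x = x @\<^sub>v (X *\<^sub>v x)"
      using mat_mult_append[OF one_carrier_mat X x] x by (simp add: E_def)
    have FEx: "F *\<^sub>v (x @\<^sub>v (X *\<^sub>v x)) = (- (D *\<^sub>v x)) @\<^sub>v (G *\<^sub>v (X *\<^sub>v x))"
      unfolding F_def using D G X x
      by (subst four_block_mat_mult_vec[of _ n n _ n _ n]) (auto simp: uminus_mult_mat_vec)
    have "x \<bullet> ((E\<^sup>T * F * E) *\<^sub>v x) = (E *\<^sub>v x) \<bullet> (F *\<^sub>v (E *\<^sub>v x))"
      using congruence_form[OF F, of "E\<^sup>T" n x] E x by simp
    also have "\<dots> = x \<bullet> (- (D *\<^sub>v x)) + (X *\<^sub>v x) \<bullet> (G *\<^sub>v (X *\<^sub>v x))"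
      unfolding Ex FEx using D G X x by (subst scalar_prod_append[of _ n _ n]) auto
    finally show ?thesis using D x by simp
  qed
  have "E\<^sup>T * F * E \<in> carrier_mat n n" using E F by auto
  then show ?thesis
    using sym form unfolding pos_def_def E_def[symmetric] F_def[symmetric] by auto
qed

text \<open>A left eigenvector suffices because a matrix and its transpose share their
  characteristic polynomial.\<close>

lemma not_schur_stableI:
  assumes M: "M \<in> carrier_mat n n" and x: "x \<in> carrier_vec n" "x \<noteq> 0\<^sub>v n" and "M\<^sup>T *\<^sub>v x = x"
  shows "\<not> schur_stable M"
proof -
  define v where "v = map_vec complex_of_real x"
  have v: "v \<in> carrier_vec n" using x by (simp add: v_def)
  have "cplx_mat M\<^sup>T *\<^sub>v v = map_vec complex_of_real (M\<^sup>T *\<^sub>v x)"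
    unfolding v_def using M x by (intro of_real_hom.mult_mat_vec_hom[symmetric]) auto
  then have "cplx_mat M\<^sup>T *\<^sub>v v = 1 \<cdot>\<^sub>v v" using assms(4) by (simp add: v_def)
  moreover have "v \<noteq> 0\<^sub>v n"
  proof
    assume "v = 0\<^sub>v n"
    then have "v $ i = 0" if "i < n" for i using that by simp
    then have "x = 0\<^sub>v n" using x by (intro eq_vecI) (auto simp: v_def)
    then show False using x by simp
  qed
  ultimately have "eigenvalue (cplx_mat M)\<^sup>T 1"
    using M v unfolding eigenvalue_def eigenvector_def
    by (auto simp: map_mat_transpose intro!: exI[of _ v])
  moreover have "cplx_mat M \<in> carrier_mat n n" using M by simp
  ultimately have "eigenvalue (cplx_mat M) 1"
    by (simp add: eigenvalue_root_char_poly[of _ n])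
  then show ?thesis unfolding schur_stable_def by auto
qed

section \<open>The matrix function on the unit circle\<close>

lemma Psi_mult_vec:
  assumes R: "R11 \<in> carrier_mat n n" "R12 \<in> carrier_mat n n" "R21 \<in> carrier_mat n n"
      "R22 \<in> carrier_mat n n"
    and v: "v \<in> carrier_vec n"
  shows "Psi R11 R12 R21 R22 z *\<^sub>v v =
    cplx_mat R11 *\<^sub>v v + cplx_mat R22 *\<^sub>v v + z \<cdot>\<^sub>v (cplx_mat R12 *\<^sub>v v)
      + inverse z \<cdot>\<^sub>v (cplx_mat R21 *\<^sub>v v)"
proof -
  have c: "cplx_mat R11 \<in> carrier_mat n n" "cplx_mat R12 \<in> carrier_mat n n"
    "cplx_mat R21 \<in> carrier_mat n n" "cplx_mat R22 \<in> carrier_mat n n"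
    using R by auto
  show ?thesis
    unfolding Psi_def using c v
    by (simp add: add_mult_distrib_mat_vec[of _ n n] smult_mat_mult_vec[of _ n n]
        assoc_add_vec[of _ n])
qed

text \<open>With z = (s - 1) / (s + 1), the equation Psi(z) x = 0 becomes s^2 Psi(1) x - 2 s (R12 -
  R21) x - Psi(-1) x = 0. The block matrix is a companion linearization of this quadratic eigenvalue
  problem, with y = s Psi(1) x as second component. The point z = -1 corresponds to the eigenvalue
  0.\<close>

lemma Psi_nonsingular_on_circle:
  fixes R11 R12 R21 R22 :: "real mat"
  defines "\<Psi> \<equiv> Psi R11 R12 R21 R22"
  assumes R: "R11 \<in> carrier_mat n n" "R12 \<in> carrier_mat n n" "R21 \<in> carrier_mat n n"
      "R22 \<in> carrier_mat n n"
    and inv: "invertible_mat (\<Psi> 1)"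
    and ev: "\<And>k. eigenvalue (four_block_mat (0\<^sub>m n n) (inv_of (\<Psi> 1)) (\<Psi> (- 1))
        (2 \<cdot>\<^sub>m (cplx_mat R12 - cplx_mat R21) * inv_of (\<Psi> 1))) k \<Longrightarrow> Re k \<noteq> 0"
    and z: "cmod z = 1" and x: "x \<in> carrier_vec n" and Px: "\<Psi> z *\<^sub>v x = 0\<^sub>v n"
  shows "x = 0\<^sub>v n"
proof (rule ccontr)
  assume x0: "x \<noteq> 0\<^sub>v n"
  define S T where "S = cplx_mat R12" and "T = cplx_mat R21"
  have ST: "S \<in> carrier_mat n n" "T \<in> carrier_mat n n" using R by (auto simp: S_def T_def)
  have P: "\<Psi> w \<in> carrier_mat n n" for w
    using R by (simp add: \<Psi>_def Psi_def)
  define Q where "Q = inv_of (\<Psi> 1)"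
  have Q: "Q \<in> carrier_mat n n" "Q * \<Psi> 1 = 1\<^sub>m n"
    using inv_of_inverse[OF P inv] by (auto simp: Q_def)
  have QP: "Q *\<^sub>v (\<Psi> 1 *\<^sub>v x) = x"
    using assoc_mult_mat_vec[OF Q(1) P[of 1] x] Q x by simp
  \<comment> \<open>Invertibility of Psi(1) excludes the one point of the circle where the Cayley
    transform is undefined.\<close>
  have z1: "z \<noteq> 1"
  proof
    assume "z = 1"
    then have "Q *\<^sub>v 0\<^sub>v n = x" using QP Px by simp
    moreover have "Q *\<^sub>v 0\<^sub>v n = 0\<^sub>v n"
      using Q(1) by (intro eq_vecI) (auto simp: scalar_prod_def)
    ultimately show False using x0 by simp
  qed
  \<comment> \<open>The Cayley transform of \<^term>\<open>z\<close> is an imaginary eigenvalue with eigenvector (x, y).\<close>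
  define s where "s = (1 + z) / (1 - z)"
  have sz: "s * (1 - z) = 1 + z" using z1 by (simp add: s_def)
  have z0: "z \<noteq> 0" using z by auto
  define y where "y = s \<cdot>\<^sub>v (\<Psi> 1 *\<^sub>v x)"
  have y: "y \<in> carrier_vec n" using mult_mat_vec_carrier[OF P x] by (simp add: y_def)
  have Qy: "Q *\<^sub>v y = s \<cdot>\<^sub>v x"
    unfolding y_def mult_mat_vec[OF Q(1) mult_mat_vec_carrier[OF P x]] QP ..
  have STc: "2 \<cdot>\<^sub>m (S - T) \<in> carrier_mat n n"
    using ST by auto
  have lower: "\<Psi> (- 1) *\<^sub>v x + (2 \<cdot>\<^sub>m (S - T) * Q) *\<^sub>v y = s \<cdot>\<^sub>v y"
  proof (rule eq_vecI)
    fix i assume "i < dim_vec (s \<cdot>\<^sub>v y)"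
    then have i: "i < n" using y by simp
    define a b c where "a = (cplx_mat R11 *\<^sub>v x + cplx_mat R22 *\<^sub>v x) $ i"
      and "b = (S *\<^sub>v x) $ i" and "c = (T *\<^sub>v x) $ i"
    have Pi: "(\<Psi> w *\<^sub>v x) $ i = a + w * b + inverse w * c" for w
      unfolding \<Psi>_def Psi_mult_vec[OF R x] a_def b_def c_def S_def T_def using i R x by simp
    have "z * (a + z * b + inverse z * c) = 0"
      using Pi[of z] Px i by simp
    then have quad: "a * z + z\<^sup>2 * b + c = 0"
      using z0 by (simp add: power2_eq_square algebra_simps)
    \<comment> \<open>Multiplying by (1 - z)^2 lets \<open>sz\<close> eliminate s; what remains is
      -4 z times the i-th coordinate of Psi(z) x.\<close>
    have "(1 - z)\<^sup>2 * (a - b - c + 2 * s * (b - c)) - (1 - z)\<^sup>2 * (s * (s * (a + b + c)))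
      = (1 - z)\<^sup>2 * (a - b - c) + 2 * (1 - z) * (s * (1 - z)) * (b - c)
        - (s * (1 - z))\<^sup>2 * (a + b + c)"
      by (simp add: power2_eq_square algebra_simps)
    also have "\<dots> = - 4 * (a * z + z\<^sup>2 * b + c)"
      unfolding sz by (simp add: power2_eq_square algebra_simps)
    finally have "(1 - z)\<^sup>2 * (a - b - c + 2 * s * (b - c)) = (1 - z)\<^sup>2 * (s * (s * (a + b + c)))"
      using quad by simp
    then have key: "a - b - c + 2 * s * (b - c) = s * (s * (a + b + c))"
      using z1 by simp
    have "(2 \<cdot>\<^sub>m (S - T) * Q) *\<^sub>v y = s \<cdot>\<^sub>v (2 \<cdot>\<^sub>v (S *\<^sub>v x - T *\<^sub>v x))"
      using assoc_mult_mat_vec[OF STc Q(1) y] ST x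
      by (simp add: Qy smult_mat_mult_vec[of _ n n] mult_mat_vec[of _ n n]
          minus_mult_distrib_mat_vec[of _ n n] minus_carrier_mat)
    then have "(\<Psi> (- 1) *\<^sub>v x + (2 \<cdot>\<^sub>m (S - T) * Q) *\<^sub>v y) $ i = a - b - c + 2 * s * (b - c)"
      using i Pi[of "- 1"] carrier_matD[OF ST(1)] carrier_matD[OF ST(2)]
      by (simp add: b_def c_def algebra_simps del: index_mult_mat_vec)
    also have "\<dots> = (s \<cdot>\<^sub>v y) $ i"
      using i Pi[of 1] carrier_matD[OF P] by (simp add: key y_def del: index_mult_mat_vec)
    finally show "(\<Psi> (- 1) *\<^sub>v x + (2 \<cdot>\<^sub>m (S - T) * Q) *\<^sub>v y) $ i = (s \<cdot>\<^sub>v y) $ i" .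
  qed (use y P x Q ST in auto)
  let ?M = "four_block_mat (0\<^sub>m n n) Q (\<Psi> (- 1)) (2 \<cdot>\<^sub>m (S - T) * Q)"
  have STQ: "2 \<cdot>\<^sub>m (S - T) * Q \<in> carrier_mat n n" using STc Q by auto
  have "?M *\<^sub>v (x @\<^sub>v y) = (0\<^sub>m n n *\<^sub>v x + Q *\<^sub>v y) @\<^sub>v (\<Psi> (- 1) *\<^sub>v x + (2 \<cdot>\<^sub>m (S - T) * Q) *\<^sub>v y)"
    by (rule four_block_mat_mult_vec[OF _ Q(1) P STQ x y]) simp
  also have "\<dots> = s \<cdot>\<^sub>v (x @\<^sub>v y)"
    unfolding lower Qy using x y by (auto intro!: eq_vecI)
  finally have Mxy: "?M *\<^sub>v (x @\<^sub>v y) = s \<cdot>\<^sub>v (x @\<^sub>v y)" .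
  have "x @\<^sub>v y \<noteq> 0\<^sub>v (n + n)"
  proof
    assume *: "x @\<^sub>v y = 0\<^sub>v (n + n)"
    have "x $ i = 0" if "i < n" for i
      using arg_cong[OF *, of "\<lambda>v. v $ i"] that x y by simp
    then have "x = 0\<^sub>v n" using x by (intro eq_vecI) auto
    then show False using x0 by simp
  qed
  moreover have "?M \<in> carrier_mat (n + n) (n + n)"
    using Q P STQ by (intro four_block_carrier_mat) auto
  ultimately have "eigenvalue ?M s"
    using Mxy x y unfolding eigenvalue_def eigenvector_def by (intro exI[of _ "x @\<^sub>v y"]) auto
  then have "Re s \<noteq> 0"
    unfolding Q_def S_def T_def by (rule ev)
  moreover have "(Re z)\<^sup>2 + (Im z)\<^sup>2 = 1"
    using z cmod_power2[of z] by simp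
  \<comment> \<open>Up to a positive factor, the real part of s is that of (1 + z)(1 - cnj z), which
    equals 1 - |z|^2.\<close>
  then have "Re s = 0"
    by (simp add: s_def Re_divide power2_eq_square algebra_simps)
  ultimately show False by simp
qed

text \<open>Expanding the form of G at w gives four terms. Unit modulus enters twice: z * cnj z = 1
  turns the pure v-term into the one of R22, and 1/z = cnj z matches the cross terms with those of
  R12 and R21.\<close>

lemma Psi_form:
  fixes Am D G :: "real mat"
  assumes Am: "Am \<in> carrier_mat n n" and D: "D \<in> carrier_mat n n" and G: "G \<in> carrier_mat n n"
    and z: "cmod z = 1" and v: "v \<in> carrier_vec n"
  defines "w \<equiv> cplx_mat Am\<^sup>T *\<^sub>v v + (- z) \<cdot>\<^sub>v v"
  shows "sform (Psi (D - Am * G * Am\<^sup>T) (Am * G) (G * Am\<^sup>T) (- G) z) v v =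
    sform (cplx_mat D) v v - sform (cplx_mat G) w w"
proof -
  define y where "y = cplx_mat Am\<^sup>T *\<^sub>v v"
  have y: "y \<in> carrier_vec n" using Am v by (simp add: y_def)
  let ?A = "cplx_mat Am" and ?G = "cplx_mat G" and ?D = "cplx_mat D"
  have c: "?A \<in> carrier_mat n n" "?G \<in> carrier_mat n n" "?D \<in> carrier_mat n n"
    "cplx_mat Am\<^sup>T \<in> carrier_mat n n" using Am D G by auto
  have AGA: "Am * G * Am\<^sup>T \<in> carrier_mat n n" using Am G by auto
  have e1: "cplx_mat (D - Am * G * Am\<^sup>T) *\<^sub>v v = ?D *\<^sub>v v - ?A *\<^sub>v (?G *\<^sub>v y)"
  proof -
    have "cplx_mat (D - Am * G * Am\<^sup>T) = ?D - ?A * ?G * cplx_mat Am\<^sup>T"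
    proof -
      have "cplx_mat (D - Am * G * Am\<^sup>T) = ?D - cplx_mat (Am * G * Am\<^sup>T)"
        using D AGA by (intro eq_matI) auto
      then show ?thesis
        using Am G by (simp add: of_real_hom.mat_hom_mult[of _ n n _ n])
    qed
    moreover have "(?A * ?G * cplx_mat Am\<^sup>T) *\<^sub>v v = ?A *\<^sub>v (?G *\<^sub>v y)"
      using c v y by (simp add: y_def assoc_mult_mat_vec[of _ n n _ n])
    ultimately show ?thesis
      using c v by (simp add: minus_mult_distrib_mat_vec[of _ n n])
  qed
  have e2: "cplx_mat (Am * G) *\<^sub>v v = ?A *\<^sub>v (?G *\<^sub>v v)"
    using Am G c v
    by (simp add: of_real_hom.mat_hom_mult[of _ n n _ n] assoc_mult_mat_vec[of _ n n _ n])
  have e3: "cplx_mat (G * Am\<^sup>T) *\<^sub>v v = ?G *\<^sub>v y"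
    using Am G c v
    by (simp add: y_def of_real_hom.mat_hom_mult[of _ n n _ n] assoc_mult_mat_vec[of _ n n _ n])
  have e4: "cplx_mat (- G) *\<^sub>v v = - (?G *\<^sub>v v)"
    using G v by (intro eq_vecI) (auto simp: scalar_prod_def sum_negf)
  have adj: "(?A *\<^sub>v (?G *\<^sub>v u)) \<bullet>c v = sform ?G u y" if "u \<in> carrier_vec n" for u
    using sform_cplx_adjoint[OF Am _ v, of "?G *\<^sub>v u"] c that by (simp add: y_def)
  have zi: "inverse z = cnj z"
    using z by (simp add: inverse_complex_def complex_eq_iff flip: cmod_power2)
  have "z * cnj z = 1" using z complex_norm_square[of z] by simp
  then have "sform ?G w w = sform ?G y y - cnj z * sform ?G y v - z * sform ?G v y + sform ?G v v"
    unfolding w_def y_def[symmetric] sform_add_smult[OF c(2) y v] by simp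
  moreover have "sform (Psi (D - Am * G * Am\<^sup>T) (Am * G) (G * Am\<^sup>T) (- G) z) v v
      = sform ?D v v - sform ?G y y - sform ?G v v + z * sform ?G v y + cnj z * sform ?G y v"
  proof -
    have "Psi (D - Am * G * Am\<^sup>T) (Am * G) (G * Am\<^sup>T) (- G) z *\<^sub>v v =
        (?D *\<^sub>v v - ?A *\<^sub>v (?G *\<^sub>v y)) + - (?G *\<^sub>v v) + z \<cdot>\<^sub>v (?A *\<^sub>v (?G *\<^sub>v v)) + cnj z \<cdot>\<^sub>v (?G *\<^sub>v y)"
    proof -
      have "D - Am * G * Am\<^sup>T \<in> carrier_mat n n" "Am * G \<in> carrier_mat n n"
        "G * Am\<^sup>T \<in> carrier_mat n n" "- G \<in> carrier_mat n n"
        using Am G AGA by (auto simp del: assoc_mult_mat intro: minus_carrier_mat)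
      from Psi_mult_vec[OF this v, of z] show ?thesis unfolding e1 e2 e3 e4 zi .
    qed
    then show ?thesis
      using c v y adj[OF y] adj[OF v]
      by (simp add: add_scalar_prod_distrib[of _ n] minus_scalar_prod_distrib[of _ n])
  qed
  ultimately show ?thesis by simp
qed

section \<open>Perturbations of a Schur matrix\<close>

lemma matched_set_nonschur:
  fixes Am D G :: "real mat"
  assumes Am: "Am \<in> carrier_mat n n" and schur: "schur_stable Am"
    and D: "D \<in> carrier_mat n n" "psd D" and G: "G \<in> carrier_mat n n" "pos_diagonal G"
    and x: "x \<in> carrier_vec n" "x \<noteq> 0\<^sub>v n"
    and le: "((Am\<^sup>T - 1\<^sub>m n) *\<^sub>v x) \<bullet> (G *\<^sub>v ((Am\<^sup>T - 1\<^sub>m n) *\<^sub>v x)) \<le> x \<bullet> (D *\<^sub>v x)"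
  shows "\<exists>X \<in> carrier_mat n n. psd (D - X * G * X\<^sup>T) \<and> \<not> schur_stable (Am + X)"
proof -
  define w where "w = (Am\<^sup>T - 1\<^sub>m n) *\<^sub>v x"
  have w: "w \<in> carrier_vec n" unfolding w_def by (rule mult_mat_vec_carrier[OF minus_carrier_mat[OF one_carrier_mat] x(1)])
  have w_eq: "w = Am\<^sup>T *\<^sub>v x - x"
    using Am x by (simp add: w_def minus_mult_distrib_mat_vec[of _ n n])
  have symD: "D\<^sup>T = D" using D by (simp add: psd_def)
  have symG: "G\<^sup>T = G" using G by (simp add: pos_diagonal_symmetric)
  \<comment> \<open>If w were 0, x would be a left eigenvector of Am for the eigenvalue 1, against
    Schur stability. This gives g > 0, hence d \<ge> g > 0, which justifies dividing by d
    below.\<close>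
  have "w \<noteq> 0\<^sub>v n"
  proof
    assume "w = 0\<^sub>v n"
    then have "(Am\<^sup>T *\<^sub>v x) $ i = x $ i" if "i < n" for i
      using that arg_cong[OF w_eq, of "\<lambda>v. v $ i"] Am x by simp
    then have "Am\<^sup>T *\<^sub>v x = x" using Am x by (intro eq_vecI) auto
    then show False using not_schur_stableI[OF Am x] schur by simp
  qed
  define g d where "g = w \<bullet> (G *\<^sub>v w)" and "d = x \<bullet> (D *\<^sub>v x)"
  have g: "0 < g" unfolding g_def using pos_diagonal_form_pos[OF G w \<open>w \<noteq> 0\<^sub>v n\<close>] .
  have gd: "g \<le> d" using le by (simp add: g_def d_def w_def)
  define X where "X = Matrix.mat n n (\<lambda>(i, j). - (D *\<^sub>v x) $ i * w $ j / d)"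
  have X: "X \<in> carrier_mat n n" by (simp add: X_def)
  have Xz: "X\<^sup>T *\<^sub>v z = (- (z \<bullet> (D *\<^sub>v x)) / d) \<cdot>\<^sub>v w" if z: "z \<in> carrier_vec n" for z
  proof (rule eq_vecI)
    fix i assume "i < dim_vec ((- (z \<bullet> (D *\<^sub>v x)) / d) \<cdot>\<^sub>v w)"
    then have i: "i < n" using w by simp
    have "(X\<^sup>T *\<^sub>v z) $ i = (\<Sum>j = 0..<n. - (D *\<^sub>v x) $ j * w $ i / d * z $ j)"
      using i z by (simp add: scalar_prod_def X_def)
    also have "\<dots> = (- (\<Sum>j = 0..<n. z $ j * (D *\<^sub>v x) $ j) / d) * w $ i"
      by (simp add: sum_distrib_left sum_distrib_right sum_divide_distrib sum_negf mult_ac)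
    finally show "(X\<^sup>T *\<^sub>v z) $ i = ((- (z \<bullet> (D *\<^sub>v x)) / d) \<cdot>\<^sub>v w) $ i"
      using i w D by (simp add: scalar_prod_def)
  qed (use w X in auto)
  have "psd (D - X * G * X\<^sup>T)"
    unfolding psd_diff_congruence_iff[OF D(1) symD G(1) symG X]
  proof
    fix z :: "real Matrix.vec" assume z: "z \<in> carrier_vec n"
    define c where "c = z \<bullet> (D *\<^sub>v x)"
    have "(X\<^sup>T *\<^sub>v z) \<bullet> (G *\<^sub>v (X\<^sup>T *\<^sub>v z)) = (c / d)\<^sup>2 * g"
      unfolding Xz[OF z] c_def[symmetric] using G w
      by (simp add: mult_mat_vec[of _ n n] g_def power2_eq_square)
    also have "\<dots> \<le> (c / d)\<^sup>2 * d"
      using gd by (intro mult_left_mono) auto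
    also have "\<dots> = c\<^sup>2 / d"
      using g gd by (simp add: power2_eq_square)
    also have "\<dots> \<le> z \<bullet> (D *\<^sub>v z)"
      using psd_Cauchy_Schwarz[OF D z x(1)] g gd by (simp add: c_def d_def)
    finally show "(X\<^sup>T *\<^sub>v z) \<bullet> (G *\<^sub>v (X\<^sup>T *\<^sub>v z)) \<le> z \<bullet> (D *\<^sub>v z)" .
  qed
  moreover have "\<not> schur_stable (Am + X)"
  proof (rule not_schur_stableI[OF _ x])
    \<comment> \<open>The divisor d in X is the value of the form of D at x, so the coefficient in
      \<open>Xz\<close> is exactly -1 for z = x.\<close>
    have "(Am + X)\<^sup>T *\<^sub>v x = Am\<^sup>T *\<^sub>v x + (- 1) \<cdot>\<^sub>v w"
      using Am X x Xz[OF x(1)] g gd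
      by (simp add: transpose_add[of _ n n] add_mult_distrib_mat_vec[of _ n n] d_def[symmetric])
    also have "\<dots> = x"
      unfolding w_eq using Am x by (intro eq_vecI) auto
    finally show "(Am + X)\<^sup>T *\<^sub>v x = x" .
  qed (use Am X in simp)
  ultimately show ?thesis using X by blast
qed

lemma matched_set_schur:
  fixes Am D G X :: "real mat" and \<Psi> :: "complex \<Rightarrow> complex mat"
  defines "\<Psi> \<equiv> Psi (D - Am * G * Am\<^sup>T) (Am * G) (G * Am\<^sup>T) (- G)"
  assumes Am: "Am \<in> carrier_mat n n" and schur: "schur_stable Am"
    and D: "D \<in> carrier_mat n n" "psd D" and G: "G \<in> carrier_mat n n" "pos_diagonal G"
    and nonsing: "\<And>z v. cmod z = 1 \<Longrightarrow> v \<in> carrier_vec n \<Longrightarrow> \<Psi> z *\<^sub>v v = 0\<^sub>v n \<Longrightarrow> v = 0\<^sub>v n"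
    and lmi: "\<And>x. x \<in> carrier_vec n \<Longrightarrow> x \<noteq> 0\<^sub>v n \<Longrightarrow>
      x \<bullet> (D *\<^sub>v x) < ((Am\<^sup>T - 1\<^sub>m n) *\<^sub>v x) \<bullet> (G *\<^sub>v ((Am\<^sup>T - 1\<^sub>m n) *\<^sub>v x))"
    and X: "X \<in> carrier_mat n n" and psdX: "psd (D - X * G * X\<^sup>T)"
  shows "schur_stable (Am + X)"
proof -
  have symD: "D\<^sup>T = D" using D by (simp add: psd_def)
  have symG: "G\<^sup>T = G" using G by (simp add: pos_diagonal_symmetric)
  have AGA: "Am * G * Am\<^sup>T \<in> carrier_mat n n" using Am G by auto
  have R: "D - Am * G * Am\<^sup>T \<in> carrier_mat n n" "Am * G \<in> carrier_mat n n"
    "G * Am\<^sup>T \<in> carrier_mat n n" "- G \<in> carrier_mat n n"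
    using Am G AGA by (auto simp del: assoc_mult_mat intro: minus_carrier_mat)
  have P: "\<Psi> z \<in> carrier_mat n n" for z
    using R by (simp add: \<Psi>_def Psi_def)
  have Gpos: "0 \<le> Re (sform (cplx_mat G) v v)" if v: "v \<in> carrier_vec n" for v
  proof -
    have "0 \<le> u \<bullet> (G *\<^sub>v u)" if "u \<in> carrier_vec n" for u
      using pos_diagonal_form_pos[OF G that] G that by (cases "u = 0\<^sub>v n") auto
    then show ?thesis unfolding sform_real[OF G(1) v] using v by simp
  qed
  have Gpos_real: "0 \<le> u \<bullet> (G *\<^sub>v u)" if "u \<in> carrier_vec n" for u
    using pos_diagonal_form_pos[OF G that] G that by (cases "u = 0\<^sub>v n") auto
  have uminus_form: "sform (- M) v v = - sform M v v"
    if "M \<in> carrier_mat n n" "v \<in> carrier_vec n" for M v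
    using that by (simp add: uminus_mult_mat_vec)
  have at_one: "0 < Re (sform (- \<Psi> 1) v v)" if v: "v \<in> carrier_vec n" "v \<noteq> 0\<^sub>v n" for v
  proof -
    define Y where "Y = Am\<^sup>T - 1\<^sub>m n"
    have Y: "Y \<in> carrier_mat n n" unfolding Y_def by (intro minus_carrier_mat one_carrier_mat)
    have Yu: "Y *\<^sub>v u \<in> carrier_vec n" if "u \<in> carrier_vec n" for u
      by (rule mult_mat_vec_carrier[OF Y that])
    define w where "w = cplx_mat Am\<^sup>T *\<^sub>v v + (- 1) \<cdot>\<^sub>v v"
    have "w = cplx_mat Y *\<^sub>v v"
    proof -
      have "cplx_mat Y = cplx_mat Am\<^sup>T - 1\<^sub>m n"
        using Am by (intro eq_matI) (auto simp: Y_def)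
      then show ?thesis
        using Am v unfolding w_def
        by (simp add: minus_mult_distrib_mat_vec[of _ n n]) (intro eq_vecI, auto)
    qed
    then have wRe: "map_vec Re w = Y *\<^sub>v map_vec Re v" "map_vec Im w = Y *\<^sub>v map_vec Im v"
      using cplx_mult_mat_vec[OF Y v(1)] by auto
    have w: "w \<in> carrier_vec n" using Am v by (simp add: w_def)
    have le: "u \<bullet> (D *\<^sub>v u) \<le> (Y *\<^sub>v u) \<bullet> (G *\<^sub>v (Y *\<^sub>v u))" if u: "u \<in> carrier_vec n" for u
    proof (cases "u = 0\<^sub>v n")
      case True
      then have "u \<bullet> (D *\<^sub>v u) = 0"
        using mult_mat_vec_carrier[OF D(1) u] by simp
      then show ?thesis using Gpos_real[OF Yu[OF u]] by simp
    qed (use lmi[OF u] in \<open>simp add: Y_def less_imp_le\<close>)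
    have c: "map_vec Re v \<in> carrier_vec n" "map_vec Im v \<in> carrier_vec n" using v by auto
    have "Re (sform (cplx_mat D) v v) < Re (sform (cplx_mat G) w w)"
      unfolding sform_real[OF D(1) v(1)] sform_real[OF G(1) w] wRe
      \<comment> \<open>The real and imaginary parts of v both satisfy the weak inequality, and
        whichever is nonzero supplies strictness.\<close>
      using map_vec_Re_Im_zero[OF v]
    proof
      assume "map_vec Re v \<noteq> 0\<^sub>v n"
      from lmi[OF c(1) this] le[OF c(2)]
      show "map_vec Re v \<bullet> (D *\<^sub>v map_vec Re v) + map_vec Im v \<bullet> (D *\<^sub>v map_vec Im v)
        < (Y *\<^sub>v map_vec Re v) \<bullet> (G *\<^sub>v (Y *\<^sub>v map_vec Re v))
          + (Y *\<^sub>v map_vec Im v) \<bullet> (G *\<^sub>v (Y *\<^sub>v map_vec Im v))"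
        unfolding Y_def[symmetric] by linarith
    next
      assume "map_vec Im v \<noteq> 0\<^sub>v n"
      from lmi[OF c(2) this] le[OF c(1)]
      show "map_vec Re v \<bullet> (D *\<^sub>v map_vec Re v) + map_vec Im v \<bullet> (D *\<^sub>v map_vec Im v)
        < (Y *\<^sub>v map_vec Re v) \<bullet> (G *\<^sub>v (Y *\<^sub>v map_vec Re v))
          + (Y *\<^sub>v map_vec Im v) \<bullet> (G *\<^sub>v (Y *\<^sub>v map_vec Im v))"
        unfolding Y_def[symmetric] by linarith
    qed
    moreover have "sform (\<Psi> 1) v v = sform (cplx_mat D) v v - sform (cplx_mat G) w w"
      using Psi_form[OF Am D(1) G(1) _ v(1), of 1] by (simp add: \<Psi>_def w_def)
    ultimately show ?thesis using uminus_form[OF P v(1)] by simp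
  qed
  have neg: "0 < Re (sform (- \<Psi> z) v v)"
    if z: "cmod z = 1" and v: "v \<in> carrier_vec n" "v \<noteq> 0\<^sub>v n" for z v
  proof -
    \<comment> \<open>The path follows the circular arc from 1 to z, so it never leaves the set
      where Psi is Hermitian and nonsingular.\<close>
    define H where "H = (\<lambda>t. - \<Psi> (cis (t * Arg z)))"
    have H: "H t \<in> carrier_mat n n" for t using P by (simp add: H_def)
    have index: "H t $$ (i, j) = - (of_real ((D - Am * G * Am\<^sup>T) $$ (i, j)) - of_real (G $$ (i, j))
        + cis (t * Arg z) * of_real ((Am * G) $$ (i, j))
        + inverse (cis (t * Arg z)) * of_real ((G * Am\<^sup>T) $$ (i, j)))"
      if "i < n" "j < n" for t i j
      using that R G(1) by (simp add: H_def \<Psi>_def Psi_def del: index_mult_mat index_minus_mat)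
    have "0 < Re (sform (H 1) v v)"
    proof (rule definite_homotopy[OF H _ _ _ _ v])
      fix i j assume ij: "i < n" "j < n"
      have "continuous_on {0..1} (\<lambda>t. cis (t * Arg z))"
        unfolding cis_conv_exp by (intro continuous_intros)
      then show "continuous_on {0..1} (\<lambda>t. H t $$ (i, j))"
        unfolding index[OF ij] by (intro continuous_intros) auto
    next
      fix t i j assume ij: "i < n" "j < n"
      have "(D - Am * G * Am\<^sup>T)\<^sup>T = D - Am * G * Am\<^sup>T"
        using D(1) AGA congruence_symmetric[OF G(1) symG Am] symD
        by (simp add: transpose_minus[OF D(1) AGA])
      note 1 = transpose_eq_index[OF this R(1) ij]
      have "(Am * G)\<^sup>T = G * Am\<^sup>T" using transpose_mult[OF Am G(1)] symG by simp
      note 2 = transpose_eq_index[OF this R(2) ij] transpose_eq_index[OF this R(2) ij(2,1)]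
      note 3 = transpose_eq_index[OF symG G(1) ij]
      \<comment> \<open>Transposition exchanges R12 and R21, and on the circle conjugation exchanges
        their coefficients.\<close>
      show "H t $$ (j, i) = cnj (H t $$ (i, j))"
        unfolding index[OF ij] index[OF ij(2,1)] 1 2 3
        by (simp add: cis_inverse cis_cnj del: index_mult_mat index_minus_mat)
    next
      fix t u assume u: "u \<in> carrier_vec n" and "H t *\<^sub>v u = 0\<^sub>v n"
      then have "- (\<Psi> (cis (t * Arg z)) *\<^sub>v u) = 0\<^sub>v n"
        using P[of "cis (t * Arg z)"] by (simp add: H_def uminus_mult_mat_vec)
      then have "\<Psi> (cis (t * Arg z)) *\<^sub>v u = 0\<^sub>v n"
        by (metis uminus_uminus_vec uminus_zero_vec)
      then show "u = 0\<^sub>v n" by (rule nonsing[OF norm_cis u])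
    next
      fix u :: "complex Matrix.vec" assume "u \<in> carrier_vec n" "u \<noteq> 0\<^sub>v n"
      then show "0 < Re (sform (H 0) u u)" using at_one by (simp add: H_def)
    qed
    moreover have "cis (Arg z) = z"
      using z cis_Arg[of z] by (cases "z = 0") (simp_all add: sgn_div_norm)
    ultimately show ?thesis by (simp add: H_def)
  qed
  have XD: "Re (sform (cplx_mat G) (cplx_mat X\<^sup>T *\<^sub>v v) (cplx_mat X\<^sup>T *\<^sub>v v))
      \<le> Re (sform (cplx_mat D) v v)" if v: "v \<in> carrier_vec n" for v
  proof -
    have XT: "X\<^sup>T \<in> carrier_mat n n" using X by simp
    have c: "cplx_mat X\<^sup>T *\<^sub>v v \<in> carrier_vec n"
      using X v by simp
    have "\<forall>x \<in> carrier_vec n. (X\<^sup>T *\<^sub>v x) \<bullet> (G *\<^sub>v (X\<^sup>T *\<^sub>v x)) \<le> x \<bullet> (D *\<^sub>v x)"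
      using psdX psd_diff_congruence_iff[OF D(1) symD G(1) symG X] by simp
    then show ?thesis
      unfolding sform_real[OF G(1) c] sform_real[OF D(1) v] cplx_mult_mat_vec[OF XT v]
      using v by (intro add_mono) auto
  qed
  define A where "A = (\<lambda>t. cplx_mat Am + complex_of_real t \<cdot>\<^sub>m cplx_mat X)"
  have A: "A t \<in> carrier_mat n n" for t using Am X by (simp add: A_def)
  have A0: "A 0 = cplx_mat Am" and A1: "A 1 = cplx_mat (Am + X)"
    using Am X by (auto simp: A_def intro!: eq_matI)
  have circle: "cmod k \<noteq> 1" if t: "t \<in> {0..1}" and k: "eigenvalue (A t) k" for t k
  proof
    assume k1: "cmod k = 1"
    have AT: "(A t)\<^sup>T \<in> carrier_mat n n" using A by simp
    have "eigenvalue (A t)\<^sup>T k"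
      using k unfolding eigenvalue_root_char_poly[OF AT] eigenvalue_root_char_poly[OF A]
      by (simp add: char_poly_transpose_mat[OF A])
    then obtain v where v: "v \<in> carrier_vec n" "v \<noteq> 0\<^sub>v n" and ev: "(A t)\<^sup>T *\<^sub>v v = k \<cdot>\<^sub>v v"
      using AT unfolding eigenvalue_def eigenvector_def by auto
    define u where "u = cplx_mat X\<^sup>T *\<^sub>v v"
    have u: "u \<in> carrier_vec n" using X v by (simp add: u_def)
    have "(A t)\<^sup>T = cplx_mat Am\<^sup>T + complex_of_real t \<cdot>\<^sub>m cplx_mat X\<^sup>T"
      using Am X by (intro eq_matI) (auto simp: A_def)
    then have "cplx_mat Am\<^sup>T *\<^sub>v v + complex_of_real t \<cdot>\<^sub>v u = k \<cdot>\<^sub>v v"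
      using ev Am X v
      by (simp add: u_def add_mult_distrib_mat_vec[of _ n n] smult_mat_mult_vec[of _ n n])
    then have *: "(cplx_mat Am\<^sup>T *\<^sub>v v) $ i + of_real t * u $ i = k * v $ i" if "i < n" for i
      using arg_cong[of _ _ "\<lambda>x. x $ i"] that Am u v
      by (metis carrier_vecD index_add_vec(1) index_smult_vec(1) index_smult_vec(2))
    \<comment> \<open>The eigenvalue equation rewrites the w of \<open>Psi_form\<close> as -t u. Its
      G-form is t^2 times that of u, hence at most that of u, and so at most the D-form of v by
      admissibility of X. Negativity of Psi(k) demands the opposite strict inequality.\<close>
    have w: "cplx_mat Am\<^sup>T *\<^sub>v v + (- k) \<cdot>\<^sub>v v = complex_of_real (- t) \<cdot>\<^sub>v u"
    proof (rule eq_vecI)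
      fix i assume "i < dim_vec (complex_of_real (- t) \<cdot>\<^sub>v u)"
      then have i: "i < n" using u by simp
      have "(cplx_mat Am\<^sup>T *\<^sub>v v) $ i = k * v $ i - of_real t * u $ i"
        using *[OF i] by (simp add: algebra_simps)
      then show "(cplx_mat Am\<^sup>T *\<^sub>v v + (- k) \<cdot>\<^sub>v v) $ i = (complex_of_real (- t) \<cdot>\<^sub>v u) $ i"
        using i Am u v by (simp del: index_mult_mat_vec)
    qed (use Am u v in auto)
    have "sform (\<Psi> k) v v = sform (cplx_mat D) v v
        - sform (cplx_mat G) (complex_of_real (- t) \<cdot>\<^sub>v u) (complex_of_real (- t) \<cdot>\<^sub>v u)"
      using Psi_form[OF Am D(1) G(1) k1 v(1)] unfolding w \<Psi>_def .
    then have "Re (sform (cplx_mat D) v v) < t\<^sup>2 * Re (sform (cplx_mat G) u u)"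
      using neg[OF k1 v] uminus_form[OF P v(1)] sform_smult[of "cplx_mat G" n u "complex_of_real (- t)"] G(1) u
      by simp
    also have "\<dots> \<le> 1 * Re (sform (cplx_mat G) u u)"
      using Gpos[OF u] t by (intro mult_right_mono) (auto simp: power_le_one)
    also have "\<dots> \<le> Re (sform (cplx_mat D) v v)"
      using XD[OF v(1)] by (simp add: u_def)
    finally show False by simp
  qed
  have "cmod k < 1" if k: "eigenvalue (A 1) k" for k
  proof (rule spectrum_homotopy[where A = A, OF A _ circle _ k])
    fix i j assume ij: "i < n" "j < n"
    have "continuous_on {0..1} (\<lambda>t. of_real (Am $$ (i, j)) + complex_of_real t * of_real (X $$ (i, j)))"
      by (intro continuous_intros)
    then show "continuous_on {0..1} (\<lambda>t. A t $$ (i, j))"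
      using ij Am X by (simp add: A_def)
  next
    fix l assume "eigenvalue (A 0) l"
    then show "cmod l < 1" using schur by (simp add: A0 schur_stable_def)
  qed
  then show ?thesis using Am X by (simp add: schur_stable_def A1)
qed

section \<open>From admissible pairs (A, B) to perturbations of Am\<close>

theorem theorem3:
  fixes n m p :: nat
    and Am Bm DA DB GA GB K L R11 R12 R21 R22 :: "real mat"
    and \<Psi> :: "complex \<Rightarrow> complex mat"
  assumes "0 < n" and "0 < m" and "0 < p" and "p \<le> m"
    and "Am \<in> carrier_mat n n" and "schur_stable Am"
    and "Bm \<in> carrier_mat n p"
    and "DA \<in> carrier_mat n n" and "psd DA"
    and "DB \<in> carrier_mat n n" and "psd DB"
    and "GA \<in> carrier_mat n n" and "pos_diagonal GA"
    and "GB \<in> carrier_mat p p" and "pos_diagonal GB"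
    and "R11 = DA - Am * GA * Am\<^sup>T" and "R12 = Am * GA"
    and "R21 = GA * Am\<^sup>T" and "R22 = - GA"
    and "\<Psi> = Psi R11 R12 R21 R22"
    and "invertible_mat (\<Psi> 1)"
    and "\<forall>k. eigenvalue
           (four_block_mat
              (0\<^sub>m n n) (inv_of (\<Psi> 1))
              (\<Psi> (- 1)) (2 \<cdot>\<^sub>m (cplx_mat R12 - cplx_mat R21) * inv_of (\<Psi> 1))) k
         \<longrightarrow> Re k \<noteq> 0"
    and "K \<in> carrier_mat m n" and "L \<in> carrier_mat m p"
    and "Sigma_KL n m Am Bm DA DB GA GB K L \<noteq> {}"
  shows "(\<forall>(A, B) \<in> Sigma_KL n m Am Bm DA DB GA GB K L. schur_stable (A + B * K))
     \<longleftrightarrow> pos_def ((1\<^sub>m n @\<^sub>r (Am\<^sup>T - 1\<^sub>m n))\<^sup>T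
                  * four_block_mat (- DA) (0\<^sub>m n n) (0\<^sub>m n n) GA
                  * (1\<^sub>m n @\<^sub>r (Am\<^sup>T - 1\<^sub>m n)))"
proof -
  note Am = assms(5) and schur = assms(6) and D = assms(8,9) and G = assms(12,13)
  note R_defs = assms(16-19)
  have symD: "DA\<^sup>T = DA" using D by (simp add: psd_def)
  have symG: "GA\<^sup>T = GA" using G by (simp add: pos_diagonal_symmetric)
  have AGA: "Am * GA * Am\<^sup>T \<in> carrier_mat n n" using Am G by auto
  have R: "R11 \<in> carrier_mat n n" "R12 \<in> carrier_mat n n" "R21 \<in> carrier_mat n n"
    "R22 \<in> carrier_mat n n"
    unfolding R_defs using Am G AGA by (auto simp del: assoc_mult_mat intro: minus_carrier_mat)
  have nonsing: "v = 0\<^sub>v n"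
    if "cmod z = 1" "v \<in> carrier_vec n" "\<Psi> z *\<^sub>v v = 0\<^sub>v n" for z v
    by (rule Psi_nonsingular_on_circle[OF R])
      (use assms(20-22) that in auto)
  obtain A0 B0 where AB0: "(A0, B0) \<in> Sigma_KL n m Am Bm DA DB GA GB K L"
    using assms(25) by auto
  have YT: "Am\<^sup>T - 1\<^sub>m n \<in> carrier_mat n n"
    by (intro minus_carrier_mat one_carrier_mat)
  have "(\<forall>(A, B) \<in> Sigma_KL n m Am Bm DA DB GA GB K L. schur_stable (A + B * K)) \<longleftrightarrow>
    (\<forall>X \<in> carrier_mat n n. psd (DA - X * GA * X\<^sup>T) \<longrightarrow> schur_stable (Am + X))"
  proof (intro iffI ballI impI)
    fix X assume X: "X \<in> carrier_mat n n" "psd (DA - X * GA * X\<^sup>T)"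
      and all: "\<forall>(A, B) \<in> Sigma_KL n m Am Bm DA DB GA GB K L. schur_stable (A + B * K)"
    \<comment> \<open>The second constraint of \<open>Sigma_KL\<close> involves only B, so
      \<open>B0\<close> from the given admissible pair can be kept while A absorbs an arbitrary X.
      This is where nonemptiness enters.\<close>
    define A where "A = Am + X - B0 * K"
    have BK: "B0 * K \<in> carrier_mat n n"
      using AB0 assms(23) by (auto simp: Sigma_KL_def)
    then have "A + B0 * K = Am + X"
      using Am X by (intro eq_matI) (auto simp: A_def simp del: index_mult_mat)
    moreover from this have "A + B0 * K - Am = X"
      using Am X by (intro eq_matI) auto
    moreover have "A \<in> carrier_mat n n"
      unfolding A_def using BK by (rule minus_carrier_mat)
    ultimately have "(A, B0) \<in> Sigma_KL n m Am Bm DA DB GA GB K L"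
      using AB0 X by (auto simp: Sigma_KL_def)
    then have "schur_stable (A + B0 * K)" using all by auto
    then show "schur_stable (Am + X)" using \<open>A + B0 * K = Am + X\<close> by simp
  next
    fix AB assume AB: "AB \<in> Sigma_KL n m Am Bm DA DB GA GB K L"
      and all: "\<forall>X \<in> carrier_mat n n. psd (DA - X * GA * X\<^sup>T) \<longrightarrow> schur_stable (Am + X)"
    obtain A B where [simp]: "AB = (A, B)" by (cases AB)
    have BK: "B * K \<in> carrier_mat n n" "A \<in> carrier_mat n n"
      using AB assms(23) by (auto simp: Sigma_KL_def)
    then have "Am + (A + B * K - Am) = A + B * K"
      using Am by (intro eq_matI) (auto simp del: index_mult_mat)
    moreover have "A + B * K - Am \<in> carrier_mat n n"
      using Am by (rule minus_carrier_mat)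
    ultimately have "schur_stable (A + B * K)"
      using all AB by (auto simp: Sigma_KL_def)
    then show "case AB of (A, B) \<Rightarrow> schur_stable (A + B * K)" by simp
  qed
  also have "\<dots> \<longleftrightarrow> (\<forall>x \<in> carrier_vec n. x \<noteq> 0\<^sub>v n \<longrightarrow>
      x \<bullet> (DA *\<^sub>v x) < ((Am\<^sup>T - 1\<^sub>m n) *\<^sub>v x) \<bullet> (GA *\<^sub>v ((Am\<^sup>T - 1\<^sub>m n) *\<^sub>v x)))"
  proof (intro iffI ballI impI)
    fix x :: "real Matrix.vec" assume all: "\<forall>X \<in> carrier_mat n n. psd (DA - X * GA * X\<^sup>T) \<longrightarrow> schur_stable (Am + X)"
      and x: "x \<in> carrier_vec n" "x \<noteq> 0\<^sub>v n"
    show "x \<bullet> (DA *\<^sub>v x) < ((Am\<^sup>T - 1\<^sub>m n) *\<^sub>v x) \<bullet> (GA *\<^sub>v ((Am\<^sup>T - 1\<^sub>m n) *\<^sub>v x))"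
    proof (rule ccontr)
      assume "\<not> ?thesis"
      then have "((Am\<^sup>T - 1\<^sub>m n) *\<^sub>v x) \<bullet> (GA *\<^sub>v ((Am\<^sup>T - 1\<^sub>m n) *\<^sub>v x)) \<le> x \<bullet> (DA *\<^sub>v x)"
        by (simp only: not_less)
      from matched_set_nonschur[OF Am schur D G x this] show False using all by blast
    qed
  next
    fix X assume lmi: "\<forall>x \<in> carrier_vec n. x \<noteq> 0\<^sub>v n \<longrightarrow>
        x \<bullet> (DA *\<^sub>v x) < ((Am\<^sup>T - 1\<^sub>m n) *\<^sub>v x) \<bullet> (GA *\<^sub>v ((Am\<^sup>T - 1\<^sub>m n) *\<^sub>v x))"
      and X: "X \<in> carrier_mat n n" "psd (DA - X * GA * X\<^sup>T)"
    show "schur_stable (Am + X)"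
      by (rule matched_set_schur[OF Am schur D G nonsing[unfolded assms(20) R_defs] _ X])
        (use lmi in blast)+
  qed
  also have "\<dots> \<longleftrightarrow> pos_def ((1\<^sub>m n @\<^sub>r (Am\<^sup>T - 1\<^sub>m n))\<^sup>T
      * four_block_mat (- DA) (0\<^sub>m n n) (0\<^sub>m n n) GA * (1\<^sub>m n @\<^sub>r (Am\<^sup>T - 1\<^sub>m n)))"
    using pos_def_lmi_iff[OF D(1) symD G(1) symG YT] by simp
  finally show ?thesis .
qed

end
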